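(* Let $q$ be an odd prime power, $d\ge2$, $Q$ a nondegenerate quadratic form on $\mathbb F_q^d$. Let $P\subseteq\mathbb F_q^d$ be nonempty, let $\mathcal S$ be a nonempty family of distinct $Q$-spheres, let $K>0$, and let $C_1\ge1$. Suppose $$\sigma(P,\mathcal S)\ge Kq^{(d-1)/2}\sqrt{|P||\mathcal S|}\qquad\text{and}\qquad\frac{64|P|}{K^2q^{d-1}}\le|\mathcal S|\le C_1Kq^{(d-1)/2}.$$ Put $n=|P|$, $s=|\mathcal S|$, $I=I(P,\mathcal S)$, and $M=\left\lceil\frac{I}{2n}\right\rceil$. Then there are two nonconcentric spheres $S_0,S_1\in\mathcal S$, a set $P'\subseteq P\cap S_0\cap S_1$, and a subfamily $\mathcal S'\subseteq\mathcal S$ such that (1) $|P'|\ge Kq^{(d-1)/2}/(8C_1)$; (2) $d_{\mathcal S}(p)\ge M$ for every $p\in P'$; (3) every $S\in\mathcal S'$ satisfies $|P'\cap S|\ge\frac{M}{2s}|P'|$, and $$\sum_{S\in\mathcal S'}|P'\cap S|\ge\frac M2|P'|,\qquad|\mathcal S'|\ge\frac M2.$$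
   Context: For $c\in\mathbb F_q^d$, $r\in\mathbb F_q$ the $Q$-sphere is $S_Q(c,r)=\{x\in\mathbb F_q^d:Q(x-c)=r\}$; spheres are parametrized by pairs $(c,r)$ and distinct spheres means distinct parameter pairs. Two spheres are nonconcentric if their centers $c,c'$ differ. $I(P,\mathcal S)=|\{(p,S)\in P\times\mathcal S:p\in S\}|$, $\sigma(P,\mathcal S)=I(P,\mathcal S)-|P||\mathcal S|/q$, and $d_{\mathcal S}(p)=|\{S\in\mathcal S:p\in S\}|$. *)

theory Defs
  imports "HOL-Analysis.Analysis"
begin

definition polar_form :: "('a::field ^ 'd \<Rightarrow> 'a) \<Rightarrow> 'a ^ 'd \<Rightarrow> 'a ^ 'd \<Rightarrow> 'a" where
  "polar_form Q x y = Q (x + y) - Q x - Q y"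

definition quadratic_form :: "('a::field ^ 'd \<Rightarrow> 'a) \<Rightarrow> bool" where
  "quadratic_form Q \<longleftrightarrow>
     (\<forall>a x. Q (a *s x) = a\<^sup>2 * Q x) \<and>
     (\<forall>y. Vector_Spaces.linear vector_scalar_mult times (\<lambda>x. polar_form Q x y)) \<and>
     (\<forall>x. Vector_Spaces.linear vector_scalar_mult times (\<lambda>y. polar_form Q x y))"

(* Intended for characteristic different from 2, where the polar form is twice
   the symmetric bilinear form associated with Q. *)
definition nondegenerate :: "('a::field ^ 'd \<Rightarrow> 'a) \<Rightarrow> bool" where
  "nondegenerate Q \<longleftrightarrow> (\<forall>x. (\<forall>y. polar_form Q x y = 0) \<longrightarrow> x = 0)"

(* A sphere is its parameter pair (centre, radius), so that spheres with different
   parameters are distinct even if their point sets happen to coincide. *)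
type_synonym ('a, 'd) sphere = "('a ^ 'd) \<times> 'a"

definition sphere_points ::
    "('a::field ^ 'd \<Rightarrow> 'a) \<Rightarrow> ('a, 'd) sphere \<Rightarrow> ('a ^ 'd) set" where
  "sphere_points Q S = {x. Q (x - fst S) = snd S}"

definition nonconcentric :: "('a, 'd) sphere \<Rightarrow> ('a, 'd) sphere \<Rightarrow> bool" where
  "nonconcentric S T \<longleftrightarrow> fst S \<noteq> fst T"

definition incidences ::
    "('a::field ^ 'd \<Rightarrow> 'a) \<Rightarrow> ('a ^ 'd) set \<Rightarrow> ('a, 'd) sphere set \<Rightarrow> nat" where
  "incidences Q P \<S> = card {(p, S). p \<in> P \<and> S \<in> \<S> \<and> p \<in> sphere_points Q S}"

definition incidence_surplus ::
    "('a::{field,finite} ^ 'd \<Rightarrow> 'a) \<Rightarrow> ('a ^ 'd) set \<Rightarrow> ('a, 'd) sphere set \<Rightarrow> real" where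
  "incidence_surplus Q P \<S> =
     real (incidences Q P \<S>) - real (card P) * real (card \<S>) / real CARD('a)"

definition sphere_degree ::
    "('a::field ^ 'd \<Rightarrow> 'a) \<Rightarrow> ('a, 'd) sphere set \<Rightarrow> 'a ^ 'd \<Rightarrow> nat" where
  "sphere_degree Q \<S> p = card {S \<in> \<S>. p \<in> sphere_points Q S}"

end

theory Submission
  imports Defs
begin

text \<open>
  The incidence surplus forces the average degree to be at least 8. Points of degree below half the
  average carry at most half of the incidences, so the points of degree at least \<open>M\<close> carry the other
  half. Concentric spheres through a common point coincide, hence every rich point lies on many
  ordered nonconcentric pairs, and averaging over all pairs gives a pair of spheres with many
  common rich points \<open>P'\<close>. Double counting incidences between \<open>P'\<close> and all spheres then yields
  the subfamily of spheres that are rich in \<open>P'\<close>.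
\<close>

lemma incidences_eq_sum_sphere_degree:
  fixes Q :: "'a::{field,finite} ^ 'd::finite \<Rightarrow> 'a"
  shows "incidences Q P \<S> = (\<Sum>p\<in>P. sphere_degree Q \<S> p)"
proof -
  have "{(p, S). p \<in> P \<and> S \<in> \<S> \<and> p \<in> sphere_points Q S}
      = (SIGMA p:P. {S \<in> \<S>. p \<in> sphere_points Q S})"
    by auto
  then show ?thesis
    by (simp add: incidences_def sphere_degree_def)
qed

lemma sum_sphere_degree:
  fixes Q :: "'a::{field,finite} ^ 'd::finite \<Rightarrow> 'a"
  shows "(\<Sum>p\<in>P. sphere_degree Q \<S> p) = (\<Sum>S\<in>\<S>. card (P \<inter> sphere_points Q S))"
  unfolding sphere_degree_def
  by (rule sum_multicount_gen) (auto simp: Int_def)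

text \<open>A point \<open>p\<close> on a sphere with centre \<open>c\<close> forces the radius to
  be \<open>Q (p - c)\<close>. This is what turns distinctness of parameter pairs into
  nonconcentricity.\<close>

lemma sphere_eqI_concentric:
  assumes "p \<in> sphere_points Q S" "p \<in> sphere_points Q T" "\<not> nonconcentric S T"
  shows "S = T"
  using assms by (auto simp: sphere_points_def nonconcentric_def prod_eq_iff)

text \<open>At a point of degree \<open>d\<close> there are \<open>d * (d - 1)\<close> ordered pairs
  of different spheres, all of them nonconcentric because the spheres share that point. Exchanging
  the order of counting gives the sum over pairs.\<close>

lemma sum_sphere_degree_pairs:
  fixes Q :: "'a::{field,finite} ^ 'd::finite \<Rightarrow> 'a"
  shows "(\<Sum>p\<in>P. sphere_degree Q \<S> p * (sphere_degree Q \<S> p - 1))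
    = (\<Sum>(S, T) \<in> {(S, T). S \<in> \<S> \<and> T \<in> \<S> \<and> nonconcentric S T}.
         card (P \<inter> sphere_points Q S \<inter> sphere_points Q T))"
    (is "_ = sum _ ?pairs")
proof -
  have "sphere_degree Q \<S> p * (sphere_degree Q \<S> p - 1)
      = card {X \<in> ?pairs. p \<in> sphere_points Q (fst X) \<inter> sphere_points Q (snd X)}" for p
  proof -
    define D where "D = {S \<in> \<S>. p \<in> sphere_points Q S}"
    have "{X \<in> ?pairs. p \<in> sphere_points Q (fst X) \<inter> sphere_points Q (snd X)}
        = (SIGMA S:D. D - {S})"
      unfolding D_def by (auto dest: sphere_eqI_concentric) (auto simp: nonconcentric_def)
    \<comment> \<open>The truncated subtraction is harmless: for empty \<open>D\<close> both sides
      vanish.\<close>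
    moreover have "card (SIGMA S:D. D - {S}) = card D * (card D - 1)"
      by (simp add: card_Diff_singleton)
    ultimately show ?thesis
      by (simp add: sphere_degree_def D_def)
  qed
  then have "(\<Sum>p\<in>P. sphere_degree Q \<S> p * (sphere_degree Q \<S> p - 1))
      = (\<Sum>p\<in>P. card {X \<in> ?pairs. p \<in> sphere_points Q (fst X) \<inter> sphere_points Q (snd X)})"
    by simp
  also have "\<dots> = (\<Sum>X\<in>?pairs. card (P \<inter> sphere_points Q (fst X) \<inter> sphere_points Q (snd X)))"
    by (rule sum_multicount_gen) (auto simp: Int_def conj_assoc)
  finally show ?thesis
    by (simp add: case_prod_beta)
qed

text \<open>The threshold \<open>t\<close> is half the average degree, so the points below it
  contribute at most \<open>card P * t\<close>, which is half of all incidences.\<close>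

lemma half_incidences_le_rich_sum:
  fixes Q :: "'a::{field,finite} ^ 'd::finite \<Rightarrow> 'a"
  assumes "P \<noteq> {}"
  shows "real (incidences Q P \<S>) / 2 \<le>
    real (\<Sum>p\<in>{p \<in> P. real (sphere_degree Q \<S> p) \<ge> real (incidences Q P \<S>) / (2 * real (card P))}.
      sphere_degree Q \<S> p)"
proof -
  let ?d = "sphere_degree Q \<S>"
  define t where "t = real (incidences Q P \<S>) / (2 * real (card P))"
  have "real (incidences Q P \<S>)
      = (\<Sum>p\<in>{p \<in> P. real (?d p) \<ge> t} \<union> {p \<in> P. real (?d p) < t}. real (?d p))"
    unfolding incidences_eq_sum_sphere_degree of_nat_sum by (rule sum.cong) auto
  also have "\<dots> = (\<Sum>p\<in>{p \<in> P. real (?d p) \<ge> t}. real (?d p))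
      + (\<Sum>p\<in>{p \<in> P. real (?d p) < t}. real (?d p))"
    by (rule sum.union_disjoint) auto
  also have "(\<Sum>p\<in>{p \<in> P. real (?d p) < t}. real (?d p)) \<le> real (card {p \<in> P. real (?d p) < t}) * t"
    by (rule sum_bounded_above) auto
  also have "\<dots> \<le> real (card P) * t"
    by (intro mult_right_mono) (auto simp: t_def intro: card_mono)
  also have "\<dots> = real (incidences Q P \<S>) / 2"
    using assms by (simp add: t_def)
  finally show ?thesis
    by (simp add: t_def)
qed

text \<open>Pigeonhole: a pair with the largest common intersection does at least as well as the
  average, and there are at most \<open>(card \<S>)\<^sup>2\<close> pairs. Positivity of the sum
  guarantees that some nonconcentric pair exists.\<close>

lemma exists_nonconcentric_rich_pair:
  fixes Q :: "'a::{field,finite} ^ 'd::finite \<Rightarrow> 'a" and \<S> :: "('a, 'd) sphere set"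
  assumes pos: "0 < (\<Sum>p\<in>P. sphere_degree Q \<S> p * (sphere_degree Q \<S> p - 1))"
  shows "\<exists>S\<in>\<S>. \<exists>T\<in>\<S>. nonconcentric S T \<and>
    (\<Sum>p\<in>P. sphere_degree Q \<S> p * (sphere_degree Q \<S> p - 1))
      \<le> (card \<S>)\<^sup>2 * card (P \<inter> sphere_points Q S \<inter> sphere_points Q T)"
proof -
  define W where "W = (\<Sum>p\<in>P. sphere_degree Q \<S> p * (sphere_degree Q \<S> p - 1))"
  define pairs where "pairs = {(S, T). S \<in> \<S> \<and> T \<in> \<S> \<and> nonconcentric S T}"
  define c where "c = (\<lambda>(S, T). card (P \<inter> sphere_points Q S \<inter> sphere_points Q T))"
  have W: "W = (\<Sum>X\<in>pairs. c X)"
    unfolding W_def pairs_def c_def by (rule sum_sphere_degree_pairs)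
  then have "pairs \<noteq> {}"
    using pos by (auto simp: W_def)
  then have "Max (c ` pairs) \<in> c ` pairs"
    by simp
  then obtain X where "X \<in> pairs" "c X = Max (c ` pairs)"
    by auto
  then have X: "X \<in> pairs" "\<And>Y. Y \<in> pairs \<Longrightarrow> c Y \<le> c X"
    by auto
  have "W \<le> card pairs * c X"
    unfolding W using sum_bounded_above[of pairs c "c X"] X(2) by simp
  also have "card pairs \<le> card (\<S> \<times> \<S>)"
    by (rule card_mono) (auto simp: pairs_def)
  finally have "W \<le> (card \<S>)\<^sup>2 * c X"
    by (simp add: card_cartesian_product power2_eq_square)
  then show ?thesis
    using X(1) unfolding W_def pairs_def c_def by auto
qed

text \<open>Each sphere outside \<open>\<T>\<close> meets \<open>A\<close> in fewer points than the
  threshold, so together they account for at most \<open>m / 2 * card A\<close> of the at least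
  \<open>m * card A\<close> incidences. The bound on \<open>card \<T>\<close> follows since one
  sphere contributes at most \<open>card A\<close>.\<close>

lemma rich_spheres:
  fixes Q :: "'a::{field,finite} ^ 'd::finite \<Rightarrow> 'a" and \<S> :: "('a, 'd) sphere set"
    and m :: real
  assumes ne: "A \<noteq> {}" and deg: "\<And>p. p \<in> A \<Longrightarrow> m \<le> real (sphere_degree Q \<S> p)"
    and "0 \<le> m" "\<S> \<noteq> {}"
  defines "\<T> \<equiv> {S \<in> \<S>. m / (2 * real (card \<S>)) * real (card A) \<le> real (card (A \<inter> sphere_points Q S))}"
  shows "m / 2 * real (card A) \<le> real (\<Sum>S\<in>\<T>. card (A \<inter> sphere_points Q S))"
    and "m / 2 \<le> real (card \<T>)"
proof -
  let ?c = "\<lambda>S. real (card (A \<inter> sphere_points Q S))"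
  let ?t = "m / (2 * real (card \<S>)) * real (card A)"
  have A: "card A > 0"
    using ne by (auto simp: card_gt_0_iff)
  have "real (card A) * m \<le> (\<Sum>p\<in>A. real (sphere_degree Q \<S> p))"
    by (rule sum_bounded_below) (rule deg)
  also have "\<dots> = (\<Sum>S\<in>\<S>. ?c S)"
    using sum_sphere_degree[of Q \<S> A] by (metis of_nat_sum)
  also have "\<dots> = (\<Sum>S\<in>\<T>. ?c S) + (\<Sum>S\<in>\<S> - \<T>. ?c S)"
    by (subst sum.subset_diff[of \<T> \<S>]) (auto simp: \<T>_def)
  also have "(\<Sum>S\<in>\<S> - \<T>. ?c S) \<le> real (card (\<S> - \<T>)) * ?t"
    by (rule sum_bounded_above) (auto simp: \<T>_def)
  also have "\<dots> \<le> real (card \<S>) * ?t"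
    using \<open>0 \<le> m\<close> by (intro mult_right_mono) (auto intro!: card_mono)
  also have "\<dots> = m / 2 * real (card A)"
    using \<open>\<S> \<noteq> {}\<close> by simp
  finally show "m / 2 * real (card A) \<le> real (\<Sum>S\<in>\<T>. card (A \<inter> sphere_points Q S))"
    by (simp add: mult.commute)
  also have "\<dots> \<le> real (card \<T>) * real (card A)"
    unfolding of_nat_sum by (rule sum_bounded_above) (auto intro: card_mono)
  finally show "m / 2 \<le> real (card \<T>)"
    using A by simp
qed

theorem proposition3p8:
  fixes Q :: "'a::{field,finite} ^ 'd::finite \<Rightarrow> 'a"
    and P :: "('a ^ 'd) set"
    and \<S> :: "('a, 'd) sphere set"
    and K C\<^sub>1 :: real
    and q d n s I :: nat
    and M :: int
  assumes "q = CARD('a)" and "odd q"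
    and "d = CARD('d)" and "d \<ge> 2"
    and "quadratic_form Q" and "nondegenerate Q"
    and "P \<noteq> {}" and "\<S> \<noteq> {}"
    and "K > 0" and "C\<^sub>1 \<ge> 1"
    and "incidence_surplus Q P \<S>
           \<ge> K * real q powr ((real d - 1) / 2) * sqrt (real (card P) * real (card \<S>))"
    and "64 * real (card P) / (K\<^sup>2 * real q ^ (d - 1)) \<le> real (card \<S>)"
    and "real (card \<S>) \<le> C\<^sub>1 * K * real q powr ((real d - 1) / 2)"
    and "n = card P" and "s = card \<S>" and "I = incidences Q P \<S>"
    and "M = \<lceil>real I / (2 * real n)\<rceil>"
  shows "\<exists>S\<^sub>0 S\<^sub>1 P' \<S>'.
           S\<^sub>0 \<in> \<S> \<and> S\<^sub>1 \<in> \<S> \<and> nonconcentric S\<^sub>0 S\<^sub>1 \<and>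
           P' \<subseteq> P \<inter> sphere_points Q S\<^sub>0 \<inter> sphere_points Q S\<^sub>1 \<and> \<S>' \<subseteq> \<S> \<and>
           real (card P') \<ge> K * real q powr ((real d - 1) / 2) / (8 * C\<^sub>1) \<and>
           (\<forall>p\<in>P'. int (sphere_degree Q \<S> p) \<ge> M) \<and>
           (\<forall>S\<in>\<S>'. real (card (P' \<inter> sphere_points Q S)) \<ge> of_int M / (2 * real s) * real (card P')) \<and>
           real (\<Sum>S\<in>\<S>'. card (P' \<inter> sphere_points Q S)) \<ge> of_int M / 2 * real (card P') \<and>
           real (card \<S>') \<ge> of_int M / 2"
proof -
  \<comment> \<open>\<open>A\<close> is the common scale: the surplus is at least
    \<open>A * sqrt (n * s)\<close>, the family has size at most \<open>C\<^sub>1 * A\<close>, and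
    the target for \<open>P'\<close> is \<open>A / (8 * C\<^sub>1)\<close>.\<close>
  define A where "A = K * real q powr ((real d - 1) / 2)"
  have q: "real q > 0" and n: "real n > 0" and s: "real s > 0"
    using assms(1,7,8,14,15) by (auto simp: card_gt_0_iff)
  have A: "A > 0"
    using q \<open>K > 0\<close> by (simp add: A_def)
  have A2: "A\<^sup>2 = K\<^sup>2 * real q ^ (d - 1)"
  proof -
    have "(real q powr ((real d - 1) / 2))\<^sup>2 = real q powr real (d - 1)"
      using \<open>d \<ge> 2\<close> by (simp add: power2_eq_square flip: powr_add)
    also have "\<dots> = real q ^ (d - 1)"
      using q by (rule powr_realpow)
    finally show ?thesis
      by (simp add: A_def power_mult_distrib)
  qed
  have sC: "real s \<le> C\<^sub>1 * A"
    using assms(13,15) by (simp add: A_def mult.assoc)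
  have "A * sqrt (real n * real s) \<le> incidence_surplus Q P \<S>"
    using assms(11,14,15) by (simp add: A_def)
  \<comment> \<open>The surplus is \<open>I\<close> minus the nonnegative term
    \<open>n * s / q\<close>.\<close>
  also have "\<dots> \<le> real I"
    using assms(16) by (simp add: incidence_surplus_def)
  finally have "(A * sqrt (real n * real s))\<^sup>2 \<le> (real I)\<^sup>2"
    using A by (intro power_mono) auto
  then have I2: "A\<^sup>2 * (real n * real s) \<le> (real I)\<^sup>2"
    by (simp add: power_mult_distrib)
  have "64 * real n / A\<^sup>2 \<le> real s"
    using assms(12,14,15) by (simp add: A2)
  then have "64 * real n \<le> A\<^sup>2 * real s"
    using A by (simp add: pos_divide_le_eq mult.commute)
  \<comment> \<open>The extra factor \<open>n\<close> makes the right side the lower bound for the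
    square of \<open>I\<close>; the constant 64 becomes the 8 in the average degree bound.\<close>
  then have "64 * real n * real n \<le> A\<^sup>2 * real s * real n"
    using n by (intro mult_right_mono) auto
  then have "(8 * real n)\<^sup>2 \<le> (real I)\<^sup>2"
    using I2 by (simp add: power2_eq_square mult.commute mult.left_commute)
  then have I8: "8 * real n \<le> real I"
    by (rule power2_le_imp_le) simp
  have MI: "real I / (2 * real n) \<le> of_int M"
    using assms(17) by simp
  \<comment> \<open>Since \<open>I / (4 * n)\<close> is at least 2, subtracting 1 from
    \<open>I / (2 * n)\<close> costs at most half of it.\<close>
  have M1: "real I / (4 * real n) \<le> of_int M - 1"
    using MI I8 n by (simp add: field_simps)
  have M0: "0 < real_of_int M"
    using M1 n by (smt (verit) divide_nonneg_nonneg of_nat_0_le_iff)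

  define R where "R = {p \<in> P. int (sphere_degree Q \<S> p) \<ge> M}"
  let ?d = "sphere_degree Q \<S>"
  \<comment> \<open>Degrees are integers, so rounding the threshold up to \<open>M\<close> loses no
    point.\<close>
  have "R = {p \<in> P. real (?d p) \<ge> real I / (2 * real n)}"
    by (auto simp: R_def assms(17) ceiling_le_iff)
  then have half: "real I / 2 \<le> (\<Sum>p\<in>R. real (?d p))"
    using half_incidences_le_rich_sum[OF \<open>P \<noteq> {}\<close>, of Q \<S>] assms(14,16) by simp
  have deg: "real_of_int M \<le> real (?d p)" if "p \<in> R" for p
  proof -
    have "real_of_int M \<le> real_of_int (int (?d p))"
      using that by (simp only: R_def mem_Collect_eq of_int_le_iff)
    then show ?thesis
      by simp
  qed
  define W where "W = (\<Sum>p\<in>R. ?d p * (?d p - 1))"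
  \<comment> \<open>The square splits into two factors: \<open>I / (4 * n)\<close> bounds
    \<open>d - 1\<close> from below at each rich point, and \<open>I / 2\<close> bounds the total
    degree of the rich points.\<close>
  have "A\<^sup>2 * real s / 8 \<le> (real I)\<^sup>2 / (8 * real n)"
    using I2 n by (simp add: field_simps)
  also have "\<dots> = real I / (4 * real n) * (real I / 2)"
    by (simp add: power2_eq_square)
  also have "\<dots> \<le> real I / (4 * real n) * (\<Sum>p\<in>R. real (?d p))"
    using half by (intro mult_left_mono) auto
  also have "\<dots> = (\<Sum>p\<in>R. real (?d p) * (real I / (4 * real n)))"
    by (subst mult.commute) (rule sum_distrib_right)
  also have "\<dots> \<le> (\<Sum>p\<in>R. real (?d p * (?d p - 1)))"
  proof (rule sum_mono)
    fix p assume "p \<in> R"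
    then have "real_of_int M \<le> real (?d p)"
      by (rule deg)
    \<comment> \<open>Positivity of \<open>M\<close> excludes degree 0, where natural subtraction
      would differ from the real one.\<close>
    with M1 M0 have "real I / (4 * real n) \<le> real (?d p - 1)"
      by (cases "?d p") auto
    then show "real (?d p) * (real I / (4 * real n)) \<le> real (?d p * (?d p - 1))"
      unfolding of_nat_mult by (rule mult_left_mono) simp
  qed
  also have "\<dots> = real W"
    by (simp add: W_def)
  finally have W: "A\<^sup>2 * real s / 8 \<le> real W" .
  moreover have "0 < A\<^sup>2 * real s / 8"
    using A s by simp
  ultimately have "0 < W"
    by linarith
  then obtain S\<^sub>0 S\<^sub>1 where S: "S\<^sub>0 \<in> \<S>" "S\<^sub>1 \<in> \<S>" "nonconcentric S\<^sub>0 S\<^sub>1"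
    and WP: "W \<le> s\<^sup>2 * card (R \<inter> sphere_points Q S\<^sub>0 \<inter> sphere_points Q S\<^sub>1)"
    using exists_nonconcentric_rich_pair[of Q \<S> R] \<open>s = card \<S>\<close> unfolding W_def by blast
  define P' where "P' = R \<inter> sphere_points Q S\<^sub>0 \<inter> sphere_points Q S\<^sub>1"
  have "real W \<le> (real s)\<^sup>2 * real (card P')"
    using WP unfolding P'_def by (metis of_nat_le_iff of_nat_mult of_nat_power)
  \<comment> \<open>One factor \<open>s\<close> cancels. Replacing the other by its upper bound
    \<open>C\<^sub>1 * A\<close> then lets one factor \<open>A\<close> cancel, leaving a bound
    linear in \<open>A\<close>.\<close>
  with W have "real s * A\<^sup>2 \<le> real s * (8 * real s * real (card P'))"
    by (simp add: power2_eq_square mult_ac)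
  then have "A\<^sup>2 \<le> 8 * real s * real (card P')"
    using s by simp
  also have "\<dots> \<le> 8 * (C\<^sub>1 * A) * real (card P')"
    using sC by (intro mult_right_mono mult_left_mono) auto
  finally have "A * A \<le> A * (8 * C\<^sub>1 * real (card P'))"
    by (simp add: power2_eq_square mult_ac)
  then have AP: "A \<le> 8 * C\<^sub>1 * real (card P')"
    using A by simp
  then have card_P': "A / (8 * C\<^sub>1) \<le> real (card P')"
    using \<open>C\<^sub>1 \<ge> 1\<close> by (simp add: field_simps)
  have "P' \<noteq> {}"
    using AP A by auto
  define \<T> where "\<T> = {S \<in> \<S>. of_int M / (2 * real s) * real (card P')
    \<le> real (card (P' \<inter> sphere_points Q S))}"
  have "of_int M / 2 * real (card P') \<le> real (\<Sum>S\<in>\<T>. card (P' \<inter> sphere_points Q S))"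
    and "of_int M / 2 \<le> real (card \<T>)"
    using rich_spheres[OF \<open>P' \<noteq> {}\<close> _ less_imp_le[OF M0] \<open>\<S> \<noteq> {}\<close>, of Q] deg
    unfolding \<T>_def \<open>s = card \<S>\<close> P'_def by auto
  moreover have "P' \<subseteq> P \<inter> sphere_points Q S\<^sub>0 \<inter> sphere_points Q S\<^sub>1"
    "\<forall>p\<in>P'. M \<le> int (?d p)"
    by (auto simp: P'_def R_def)
  ultimately show ?thesis
    using S card_P' unfolding A_def
    by (intro exI[of _ S\<^sub>0] exI[of _ S\<^sub>1] exI[of _ P'] exI[of _ \<T>]) (simp add: \<T>_def)
qed

end
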